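(* Fix $C_0,c>0$. For primes $p\to\infty$, set $$n=\lfloor p/C_0\rfloor,\qquad r=\left\lceil\frac{cn}{\ln p}\right\rceil,\qquad b=n-r.$$ For all sufficiently large primes $p$ there is a nonempty $S=S_p\subseteq\mathbb F_p^n$ such that every linear map $L:\mathbb F_p^n\to\mathbb F_p^b$ has an empty fiber on $S$ (i.e. $S\cap L^{-1}(y)=\emptyset$ for some $y\in\mathbb F_p^b$) and, as $p\to\infty$, $$\mu=\frac{|S|}{p^b}=(1+o(1))\frac{np}{10}=(1+o(1))\frac{p^2}{10C_0},\qquad \frac{|S|}{p^n}=\exp(-cn+O(\ln p)).$$ For every positive integer $m\le|S|$, one can choose an $m$-element subset of $S$ with the same property that every linear map $\mathbb F_p^n\to\mathbb F_p^b$ has an empty fiber on it. Consequently, for fixed $0<\tau,\delta<1$, no sufficient mean threshold $o(n^2)$ can guarantee a $\tau$-balanced fraction $1-\delta$ for every subset in this parameter range: for every function $T$ with $T(n)=o(n^2)$, it is false that for all sufficiently large primes $p$ (with $n=\lfloor p/C_0\rfloor$, $r=\lceil cn/\ln p\rceil$, $b=n-r$) every nonempty $S'\subseteq\mathbb F_p^n$ with $|S'|/p^b\ge T(n)$ has at least a fraction $1-\delta$ of the surjective linear maps $\mathbb F_p^n\to\mathbb F_p^b$ being $\tau$-balanced with respect to $S'$.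
   Context: For nonempty $S\subseteq\mathbb F_p^n$ and $\mu=|S|/p^b$, a linear map $L:\mathbb F_p^n\to\mathbb F_p^b$ is called $\tau$-balanced with respect to $S$ if $(1-\tau)\mu\le|S\cap L^{-1}(y)|\le(1+\tau)\mu$ for every $y\in\mathbb F_p^b$. The fibers of $L$ on $S$ are the sets $S\cap L^{-1}(y)$, $y\in\mathbb F_p^b$. The $o(\cdot)$ and $O(\cdot)$ terms are as $p\to\infty$ along primes, with $C_0,c$ fixed (implied constants may depend on $C_0,c$). *)

theory Defs
  imports Complex_Main "HOL-Library.Landau_Symbols" "HOL-Number_Theory.Residues" "HOL-Algebra.Module"
begin

section \<open>Coordinate spaces and linear maps\<close>

text \<open>
  Since the prime varies inside the statement, the field with \<open>p\<close> elements is the carrier-based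
  \<^const>\<open>residue_ring\<close>, and vectors are extensional functions on \<open>{..<n}\<close>. The multiplicative
  fields of the \<open>module\<close> record carry no meaning for a module and are left unspecified.
\<close>

definition coord_space :: "('a, 'r) ring_scheme \<Rightarrow> nat \<Rightarrow> ('a, nat \<Rightarrow> 'a) module" where
  "coord_space R n =
    \<lparr>carrier = {..<n} \<rightarrow>\<^sub>E carrier R,
     monoid.mult = undefined,
     one = undefined,
     zero = (\<lambda>i\<in>{..<n}. \<zero>\<^bsub>R\<^esub>),
     add = (\<lambda>x y. \<lambda>i\<in>{..<n}. x i \<oplus>\<^bsub>R\<^esub> y i),
     smult = (\<lambda>a x. \<lambda>i\<in>{..<n}. a \<otimes>\<^bsub>R\<^esub> x i)\<rparr>"

lemma module_coord_space:
  assumes "cring R"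
  shows "module R (coord_space R n)"
proof -
  interpret R: cring R by fact
  show ?thesis
  proof (rule moduleI)
    show "abelian_group (coord_space R n)"
    proof (rule abelian_groupI)
      fix x assume x: "x \<in> carrier (coord_space R n)"
      show "\<exists>y\<in>carrier (coord_space R n). y \<oplus>\<^bsub>coord_space R n\<^esub> x = \<zero>\<^bsub>coord_space R n\<^esub>"
        by (rule bexI[of _ "\<lambda>i\<in>{..<n}. \<ominus>\<^bsub>R\<^esub> x i"])
           (use x in \<open>auto simp: coord_space_def PiE_iff R.l_neg intro!: restrict_ext\<close>)
    qed (auto simp: coord_space_def PiE_iff R.a_ac extensional_def
               intro!: ext)
  qed (auto simp: coord_space_def PiE_iff R.l_distr R.r_distr R.m_assoc extensional_def assms
            intro!: ext)
qed

text \<open>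
  Maps are extensional, so that distinct elements of this set are distinct as maps on the carrier
  and cardinalities of sets of linear maps are the intended ones.
\<close>

definition linear_maps ::
    "('a, 'r) ring_scheme \<Rightarrow> ('a, 'b, 's) module_scheme \<Rightarrow> ('a, 'c, 't) module_scheme \<Rightarrow> ('b \<Rightarrow> 'c) set" where
  "linear_maps R V W =
    {L \<in> carrier V \<rightarrow>\<^sub>E carrier W.
       (\<forall>x\<in>carrier V. \<forall>y\<in>carrier V. L (x \<oplus>\<^bsub>V\<^esub> y) = L x \<oplus>\<^bsub>W\<^esub> L y) \<and>
       (\<forall>a\<in>carrier R. \<forall>x\<in>carrier V. L (a \<odot>\<^bsub>V\<^esub> x) = a \<odot>\<^bsub>W\<^esub> L x)}"

definition Fp :: "nat \<Rightarrow> int ring" where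
  "Fp p = residue_ring (int p)"

definition Fp_space :: "nat \<Rightarrow> nat \<Rightarrow> (int, nat \<Rightarrow> int) module" where
  "Fp_space p n = coord_space (Fp p) n"

definition Fp_linear_maps :: "nat \<Rightarrow> nat \<Rightarrow> nat \<Rightarrow> ((nat \<Rightarrow> int) \<Rightarrow> (nat \<Rightarrow> int)) set" where
  "Fp_linear_maps p n b = linear_maps (Fp p) (Fp_space p n) (Fp_space p b)"

definition Fp_surj_linear_maps :: "nat \<Rightarrow> nat \<Rightarrow> nat \<Rightarrow> ((nat \<Rightarrow> int) \<Rightarrow> (nat \<Rightarrow> int)) set" where
  "Fp_surj_linear_maps p n b =
    {L \<in> Fp_linear_maps p n b. L ` carrier (Fp_space p n) = carrier (Fp_space p b)}"


section \<open>Fibers and balanced maps\<close>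

definition fiber :: "('b \<Rightarrow> 'c) \<Rightarrow> 'b set \<Rightarrow> 'c \<Rightarrow> 'b set" where
  "fiber L S y = S \<inter> L -` {y}"

definition mean_fiber :: "nat \<Rightarrow> nat \<Rightarrow> (nat \<Rightarrow> int) set \<Rightarrow> real" where
  "mean_fiber p b S = real (card S) / real p ^ b"

definition balanced ::
    "nat \<Rightarrow> nat \<Rightarrow> real \<Rightarrow> (nat \<Rightarrow> int) set \<Rightarrow> ((nat \<Rightarrow> int) \<Rightarrow> (nat \<Rightarrow> int)) \<Rightarrow> bool" where
  "balanced p b \<tau> S L \<longleftrightarrow>
    (\<forall>y\<in>carrier (Fp_space p b).
       (1 - \<tau>) * mean_fiber p b S \<le> real (card (fiber L S y)) \<and>
       real (card (fiber L S y)) \<le> (1 + \<tau>) * mean_fiber p b S)"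

definition all_maps_miss :: "nat \<Rightarrow> nat \<Rightarrow> nat \<Rightarrow> (nat \<Rightarrow> int) set \<Rightarrow> bool" where
  "all_maps_miss p n b S \<longleftrightarrow>
    (\<forall>L\<in>Fp_linear_maps p n b. \<exists>y\<in>carrier (Fp_space p b). fiber L S y = {})"

definition balanced_fraction :: "nat \<Rightarrow> nat \<Rightarrow> nat \<Rightarrow> real \<Rightarrow> (nat \<Rightarrow> int) set \<Rightarrow> real" where
  "balanced_fraction p n b \<tau> S =
    real (card {L \<in> Fp_surj_linear_maps p n b. balanced p b \<tau> S L}) /
    real (card (Fp_surj_linear_maps p n b))"


section \<open>The parameter range\<close>

definition primes_at_top :: "nat filter" where
  "primes_at_top = inf at_top (principal {p. prime p})"

definition param_n :: "real \<Rightarrow> nat \<Rightarrow> nat" where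
  "param_n C\<^sub>0 p = nat \<lfloor>real p / C\<^sub>0\<rfloor>"

definition param_r :: "real \<Rightarrow> real \<Rightarrow> nat \<Rightarrow> nat" where
  "param_r C\<^sub>0 c p = nat \<lceil>c * real (param_n C\<^sub>0 p) / ln (real p)\<rceil>"

text \<open>
  The natural-number subtraction truncates only for finitely many \<open>p\<close>, as \<open>r = o(n)\<close>; all uses are
  under \<^const>\<open>primes_at_top\<close>.
\<close>

definition param_b :: "real \<Rightarrow> real \<Rightarrow> nat \<Rightarrow> nat" where
  "param_b C\<^sub>0 c p = param_n C\<^sub>0 p - param_r C\<^sub>0 c p"

end

theory Submission
  imports Defs "HOL-Real_Asymp.Real_Asymp"
begin

text \<open>
  The fibers of a surjective linear map on \<open>S\<close> are the intersections of \<open>S\<close> with the translates of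
  its kernel \<open>K\<close>, a subspace with \<open>p ^ r\<close> elements. So a large set \<open>S\<close> is wanted such that every
  subspace of this size has a translate disjoint from \<open>S\<close>; maps that are not surjective have an empty
  fiber anyway. The property passes to subsets, so it suffices to find one such set whose
  mean fiber is slightly above \<open>n p / 10\<close> and to shrink it.

  The set comes from the planar Kakeya construction: the points \<open>(x, y)\<close> with \<open>x \<noteq> 0\<close> and
  \<open>y + x\<^sup>2\<close> a nonresidue make up about half of the plane but miss a line in every direction, since
  on a suitable parallel line \<open>y + x\<^sup>2\<close> becomes a perfect square, or, for the vertical
  direction, \<open>x\<close> vanishes. Require the first \<open>s = r - 3\<close>
  coordinates to vanish, cut the others into blocks of four, and let the set consist of all
  vectors that have, in at least one block, their last two entries zero and their first two in the planar set
  (\<open>nonresidue_set\<close>). If \<open>K\<close> does not project onto the first \<open>s\<close> coordinates, a translate avoids the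
  set altogether. If it does, only the at most \<open>p\<^sup>3\<close> vectors of \<open>K\<close> vanishing there matter. In a given
  block, either they do not project onto the last two coordinates, or those that vanish
  in these number at most \<open>p\<close> and trace out at most a line in the plane of the first two; in both
  cases a shift of this block avoids the block condition (\<open>ex_shift_avoiding_nonresidues\<close>).
  Different blocks use different coordinates, so one translate of \<open>K\<close> avoids the conditions of
  all blocks simultaneously (\<open>ex_translate_avoiding_nonresidue_set\<close>).

  Each block contributes about \<open>p / 2\<close> to the mean fiber and there are about \<open>n / 4\<close> blocks, with
  negligible overlap, so the mean is about \<open>n p / 8\<close> and exceeds \<open>n p / 10\<close>
  (\<open>card_nonresidue_set_large\<close>). Dividing by \<open>p ^ r\<close>, which is \<open>exp (c n)\<close> up to a factor at most
  \<open>p\<close>, gives the density. Finally, an empty fiber rules out balancedness for every surjective map at once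
  (\<open>balanced_fraction_eq_0\<close>), while a threshold in \<open>o(n\<^sup>2)\<close> eventually lies below the mean, which is of
  order \<open>p\<^sup>2\<close> and hence of order \<open>n\<^sup>2\<close>.
\<close>

section \<open>Coordinate spaces over the prime field\<close>

lemma carrier_Fp_space: "carrier (Fp_space p n) = {..<n} \<rightarrow>\<^sub>E {0..<int p}"
proof -
  have "{0..int p - 1} = {0..<int p}" by auto
  then show ?thesis by (simp add: Fp_space_def coord_space_def Fp_def residue_ring_def)
qed

lemma add_Fp_space:
  "x \<oplus>\<^bsub>Fp_space p n\<^esub> y = (\<lambda>i\<in>{..<n}. (x i + y i) mod int p)"
  by (simp add: Fp_space_def coord_space_def Fp_def residue_ring_def)

lemma smult_Fp_space:
  "t \<odot>\<^bsub>Fp_space p n\<^esub> x = (\<lambda>i\<in>{..<n}. (t * x i) mod int p)"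
  by (simp add: Fp_space_def coord_space_def Fp_def residue_ring_def)

lemma zero_Fp_space: "\<zero>\<^bsub>Fp_space p n\<^esub> = (\<lambda>i\<in>{..<n}. 0)"
  by (simp add: Fp_space_def coord_space_def Fp_def residue_ring_def)

lemma card_Fp_space: "card (carrier (Fp_space p n)) = p ^ n"
  by (simp add: carrier_Fp_space card_PiE)

lemma finite_Fp_space: "finite (carrier (Fp_space p n))"
  by (simp add: carrier_Fp_space finite_PiE)

lemma Fp_space_coord:
  assumes "x \<in> carrier (Fp_space p n)" "i < n"
  shows "0 \<le> x i" "x i < int p" "x i mod int p = x i"
proof -
  have "x i \<in> {0..<int p}" using assms by (simp add: carrier_Fp_space PiE_iff)
  then show "0 \<le> x i" "x i < int p" "x i mod int p = x i" by simp_all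
qed

lemma Fp_space_ext:
  assumes "x \<in> carrier (Fp_space p n)" "y \<in> carrier (Fp_space p n)" "\<And>i. i < n \<Longrightarrow> x i = y i"
  shows "x = y"
proof (rule PiE_ext)
  show "x \<in> {..<n} \<rightarrow>\<^sub>E {0..<int p}" "y \<in> {..<n} \<rightarrow>\<^sub>E {0..<int p}"
    using assms(1,2) by (simp_all add: carrier_Fp_space)
  show "x i = y i" if "i \<in> {..<n}" for i using assms(3) that by blast
qed

lemma Fp_space_closed:
  assumes "p > 0"
  shows "x \<oplus>\<^bsub>Fp_space p n\<^esub> y \<in> carrier (Fp_space p n)"
    and "t \<odot>\<^bsub>Fp_space p n\<^esub> x \<in> carrier (Fp_space p n)"
    and "\<zero>\<^bsub>Fp_space p n\<^esub> \<in> carrier (Fp_space p n)"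
proof -
  have m: "z mod int p \<in> {0..<int p}" for z using assms by simp
  show "x \<oplus>\<^bsub>Fp_space p n\<^esub> y \<in> carrier (Fp_space p n)"
    "t \<odot>\<^bsub>Fp_space p n\<^esub> x \<in> carrier (Fp_space p n)"
    unfolding carrier_Fp_space add_Fp_space smult_Fp_space restrict_PiE_iff using m by blast+
  show "\<zero>\<^bsub>Fp_space p n\<^esub> \<in> carrier (Fp_space p n)"
    unfolding carrier_Fp_space zero_Fp_space restrict_PiE_iff using assms by simp
qed

lemma Fp_space_zero_add:
  assumes "p > 0" "y \<in> carrier (Fp_space p n)"
  shows "\<zero>\<^bsub>Fp_space p n\<^esub> \<oplus>\<^bsub>Fp_space p n\<^esub> y = y"
proof (rule Fp_space_ext[OF Fp_space_closed(1)[OF assms(1)] assms(2)])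
  fix i assume i: "i < n"
  have "(\<zero>\<^bsub>Fp_space p n\<^esub> \<oplus>\<^bsub>Fp_space p n\<^esub> y) i = (0 + y i) mod int p"
    unfolding add_Fp_space zero_Fp_space using i by (simp only: restrict_apply lessThan_iff if_True)
  then show "(\<zero>\<^bsub>Fp_space p n\<^esub> \<oplus>\<^bsub>Fp_space p n\<^esub> y) i = y i"
    using Fp_space_coord(3)[OF assms(2) i] by (simp only: add_0)
qed

lemma Fp_space_smult_zero: "t \<odot>\<^bsub>Fp_space p n\<^esub> \<zero>\<^bsub>Fp_space p n\<^esub> = \<zero>\<^bsub>Fp_space p n\<^esub>"
  unfolding smult_Fp_space zero_Fp_space
  by (rule restrict_ext) (simp only: restrict_apply if_True mult_zero_right mod_0)

lemma Fp_space_add_cancel: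
  assumes "k \<in> carrier (Fp_space p n)" "k' \<in> carrier (Fp_space p n)"
    and "k \<oplus>\<^bsub>Fp_space p n\<^esub> z = k' \<oplus>\<^bsub>Fp_space p n\<^esub> z"
  shows "k = k'"
proof (rule Fp_space_ext[OF assms(1,2)])
  fix i assume i: "i < n"
  have "(k i + z i) mod int p = (k' i + z i) mod int p"
    using fun_cong[OF assms(3), of i] i by (simp add: add_Fp_space)
  then have "[k i = k' i] (mod int p)"
    by (simp add: unique_euclidean_semiring_class.cong_def[symmetric] cong_add_rcancel)
  then show "k i = k' i" using Fp_space_coord[OF assms(1) i] Fp_space_coord[OF assms(2) i]
    by (simp add: unique_euclidean_semiring_class.cong_def)
qed

lemma Fp_linear_mapsD:
  assumes "L \<in> Fp_linear_maps p n b"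
  shows "x \<in> carrier (Fp_space p n) \<Longrightarrow> L x \<in> carrier (Fp_space p b)"
    and "x \<in> carrier (Fp_space p n) \<Longrightarrow> y \<in> carrier (Fp_space p n) \<Longrightarrow>
      L (x \<oplus>\<^bsub>Fp_space p n\<^esub> y) = L x \<oplus>\<^bsub>Fp_space p b\<^esub> L y"
    and "t \<in> {0..<int p} \<Longrightarrow> x \<in> carrier (Fp_space p n) \<Longrightarrow>
      L (t \<odot>\<^bsub>Fp_space p n\<^esub> x) = t \<odot>\<^bsub>Fp_space p b\<^esub> L x"
proof -
  have "carrier (Fp p) = {0..<int p}" by (auto simp: Fp_def residue_ring_def)
  then show "x \<in> carrier (Fp_space p n) \<Longrightarrow> L x \<in> carrier (Fp_space p b)"
    "x \<in> carrier (Fp_space p n) \<Longrightarrow> y \<in> carrier (Fp_space p n) \<Longrightarrow>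
      L (x \<oplus>\<^bsub>Fp_space p n\<^esub> y) = L x \<oplus>\<^bsub>Fp_space p b\<^esub> L y"
    "t \<in> {0..<int p} \<Longrightarrow> x \<in> carrier (Fp_space p n) \<Longrightarrow>
      L (t \<odot>\<^bsub>Fp_space p n\<^esub> x) = t \<odot>\<^bsub>Fp_space p b\<^esub> L x"
    using assms unfolding Fp_linear_maps_def linear_maps_def by blast+
qed

section \<open>Subspaces and kernels\<close>

text \<open>
  Subsets closed under both operations suffice here: they are handled only through their
  cardinalities, so neither bases nor dimensions are introduced.
\<close>

definition Fp_subspace :: "nat \<Rightarrow> nat \<Rightarrow> (nat \<Rightarrow> int) set \<Rightarrow> bool" where
  "Fp_subspace p n K \<longleftrightarrow> K \<subseteq> carrier (Fp_space p n) \<and>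
     (\<forall>x\<in>K. \<forall>y\<in>K. x \<oplus>\<^bsub>Fp_space p n\<^esub> y \<in> K) \<and>
     (\<forall>t\<in>{0..<int p}. \<forall>x\<in>K. t \<odot>\<^bsub>Fp_space p n\<^esub> x \<in> K)"

text \<open>
  The elementary half of the first isomorphism theorem. Choose a preimage of every
  \<open>y \<in> Y\<close>; translating \<open>N\<close> by these preimages gives disjoint copies of \<open>N\<close> inside \<open>K\<close>. This one
  inequality replaces rank and nullity throughout, both for linear maps and for coordinate projections.
\<close>

lemma card_kernel_le:
  assumes fin: "finite K"
    and onto: "Y \<subseteq> f ` K"
    and closed: "\<And>k z. k \<in> N \<Longrightarrow> z \<in> K \<Longrightarrow> pl k z \<in> K"
    and kernel: "\<And>k z. k \<in> N \<Longrightarrow> z \<in> K \<Longrightarrow> f (pl k z) = f z"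
    and cancel: "\<And>k k' z. k \<in> N \<Longrightarrow> k' \<in> N \<Longrightarrow> z \<in> K \<Longrightarrow> pl k z = pl k' z \<Longrightarrow> k = k'"
  shows "card N * card Y \<le> card K"
proof -
  have "\<forall>y\<in>Y. \<exists>z. z \<in> K \<and> f z = y" using onto by fast
  then obtain g where g: "\<And>y. y \<in> Y \<Longrightarrow> g y \<in> K \<and> f (g y) = y" by metis
  let ?h = "\<lambda>(k, y). pl k (g y)"
  have "inj_on ?h (N \<times> Y)"
  proof (rule inj_onI, clarify)
    fix k y k' y' assume *: "k \<in> N" "y \<in> Y" "k' \<in> N" "y' \<in> Y" "pl k (g y) = pl k' (g y')"
    then have "y = y'" by (metis g kernel)
    then show "k = k' \<and> y = y'" using * cancel g by metis
  qed
  moreover have "?h ` (N \<times> Y) \<subseteq> K" using closed g by auto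
  ultimately have "card (N \<times> Y) \<le> card K" using fin by (meson card_inj_on_le)
  then show ?thesis by (simp add: card_cartesian_product)
qed

lemma subspace_vanishing:
  assumes "Fp_subspace p n K" "I \<subseteq> {..<n}"
  shows "Fp_subspace p n {k \<in> K. \<forall>i\<in>I. k i = 0}"
  using assms by (auto simp: Fp_subspace_def add_Fp_space smult_Fp_space)

text \<open>
  The kernel bound applied to the projection of \<open>K\<close> onto the coordinates in \<open>I\<close>: if that
  projection is onto, forcing these coordinates to vanish costs a full factor \<open>p ^ card I\<close>.
\<close>

lemma card_vanishing_le:
  assumes K: "Fp_subspace p n K" and I: "I \<subseteq> {..<n}"
    and onto: "\<And>w. w \<in> I \<rightarrow>\<^sub>E {0..<int p} \<Longrightarrow> \<exists>k\<in>K. \<forall>i\<in>I. k i = w i"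
  shows "card {k \<in> K. \<forall>i\<in>I. k i = 0} * p ^ card I \<le> card K"
proof -
  have sub: "K \<subseteq> carrier (Fp_space p n)" using K by (simp add: Fp_subspace_def)
  have fI: "finite I" using I finite_subset by blast
  have "card {k \<in> K. \<forall>i\<in>I. k i = 0} * card (I \<rightarrow>\<^sub>E {0..<int p}) \<le> card K"
  proof (rule card_kernel_le[where f = "\<lambda>k. restrict k I" and pl = "add (Fp_space p n)"])
    show "finite K" using sub finite_Fp_space finite_subset by blast
    show "(I \<rightarrow>\<^sub>E {0..<int p}) \<subseteq> (\<lambda>k. restrict k I) ` K"
    proof
      fix w assume w: "w \<in> I \<rightarrow>\<^sub>E {0..<int p}"
      obtain k where "k \<in> K" "\<forall>i\<in>I. k i = w i" using onto[OF w] by blast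
      moreover from this have "w = restrict k I"
        using w by (auto simp: fun_eq_iff PiE_iff extensional_def)
      ultimately show "w \<in> (\<lambda>k. restrict k I) ` K" by blast
    qed
  next
    fix k z assume "k \<in> {k \<in> K. \<forall>i\<in>I. k i = 0}" "z \<in> K"
    then show "k \<oplus>\<^bsub>Fp_space p n\<^esub> z \<in> K" using K by (auto simp: Fp_subspace_def)
  next
    fix k z assume *: "k \<in> {k \<in> K. \<forall>i\<in>I. k i = 0}" "z \<in> K"
    show "restrict (k \<oplus>\<^bsub>Fp_space p n\<^esub> z) I = restrict z I"
    proof (rule restrict_ext)
      fix i assume "i \<in> I"
      then show "(k \<oplus>\<^bsub>Fp_space p n\<^esub> z) i = z i"
        using * I sub Fp_space_coord(3)[of z p n i] by (auto simp: add_Fp_space)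
    qed
  next
    fix k k' z assume "k \<in> {k \<in> K. \<forall>i\<in>I. k i = 0}" "k' \<in> {k \<in> K. \<forall>i\<in>I. k i = 0}"
      "k \<oplus>\<^bsub>Fp_space p n\<^esub> z = k' \<oplus>\<^bsub>Fp_space p n\<^esub> z"
    then show "k = k'" using sub Fp_space_add_cancel by blast
  qed
  then show ?thesis using fI by (simp add: card_PiE)
qed

lemma kernel_subspace:
  assumes L: "L \<in> Fp_linear_maps p n b" and "p > 0"
  defines "K \<equiv> {k \<in> carrier (Fp_space p n). L k = \<zero>\<^bsub>Fp_space p b\<^esub>}"
  shows "Fp_subspace p n K"
proof -
  note lin = Fp_linear_mapsD[OF L] and closed = Fp_space_closed[OF \<open>p > 0\<close>]
  have K: "k \<in> carrier (Fp_space p n)" "L k = \<zero>\<^bsub>Fp_space p b\<^esub>" if "k \<in> K" for k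
    using that by (simp_all add: K_def)
  have KI: "k \<in> K" if "k \<in> carrier (Fp_space p n)" "L k = \<zero>\<^bsub>Fp_space p b\<^esub>" for k
    using that by (simp add: K_def)
  have "x \<oplus>\<^bsub>Fp_space p n\<^esub> y \<in> K" if "x \<in> K" "y \<in> K" for x y
  proof (rule KI[OF closed(1)])
    show "L (x \<oplus>\<^bsub>Fp_space p n\<^esub> y) = \<zero>\<^bsub>Fp_space p b\<^esub>"
      unfolding lin(2)[OF K(1)[OF that(1)] K(1)[OF that(2)]] K(2)[OF that(1)] K(2)[OF that(2)]
      by (rule Fp_space_zero_add[OF \<open>p > 0\<close> closed(3)])
  qed
  moreover have "t \<odot>\<^bsub>Fp_space p n\<^esub> x \<in> K" if "t \<in> {0..<int p}" "x \<in> K" for t x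
  proof (rule KI[OF closed(2)])
    show "L (t \<odot>\<^bsub>Fp_space p n\<^esub> x) = \<zero>\<^bsub>Fp_space p b\<^esub>"
      unfolding lin(3)[OF that(1) K(1)[OF that(2)]] K(2)[OF that(2)]
      by (rule Fp_space_smult_zero)
  qed
  ultimately show ?thesis using K(1) unfolding Fp_subspace_def by blast
qed

section \<open>A set missed by every linear map\<close>

text \<open>
  The four coordinates starting at \<open>a\<close> form a block; its last two entries vanish and its first
  two lie in the set of \<open>(x, y)\<close> with \<open>x \<noteq> 0\<close> and \<open>y + x\<^sup>2\<close> not a square. This planar set has about
  \<open>p\<^sup>2 / 2\<close> points, and its complement contains a line in every direction (a planar Kakeya set).
  Zero counts as a square for \<^const>\<open>QuadRes\<close>.
\<close>

definition nonresidue_piece :: "nat \<Rightarrow> nat \<Rightarrow> nat \<Rightarrow> nat \<Rightarrow> (nat \<Rightarrow> int) set" where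
  "nonresidue_piece p n s a = {x \<in> carrier (Fp_space p n). (\<forall>i<s. x i = 0) \<and> x (a+2) = 0 \<and> x (a+3) = 0 \<and>
     x a \<noteq> 0 \<and> \<not> QuadRes (int p) (x (a+1) + (x a)\<^sup>2)}"

definition nonresidue_set :: "nat \<Rightarrow> nat \<Rightarrow> nat \<Rightarrow> nat \<Rightarrow> (nat \<Rightarrow> int) set" where
  "nonresidue_set p n s N = (\<Union>j<N. nonresidue_piece p n s (s + 4 * j))"

text \<open>
  The geometric core, for one block. If \<open>K\<close> does not project onto the last two block
  coordinates, shifting by the negative of a vector outside the image keeps them from vanishing together.
  Otherwise the vectors of \<open>K\<close> vanishing there form a subspace of at most \<open>p\<close> elements. Either all
  of them have first coordinate zero, and no shift is needed, or they are the multiples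
  \<open>t \<cdot> d\<close> of one vector with \<open>d a \<noteq> 0\<close>. In the latter case shift the second coordinate by \<open>f\<^sup>2\<close>
  with \<open>2 d a f = d (a + 1)\<close>: completing the square,
  \<open>f\<^sup>2 + t d (a + 1) + (t d a)\<^sup>2 = (f + t d a)\<^sup>2\<close>, so the whole line consists of squares.
\<close>

lemma ex_shift_avoiding_nonresidues:
  fixes a :: nat
  assumes p: "prime p" "odd p" and a: "a + 4 \<le> n"
    and K: "Fp_subspace p n K" and card: "card K \<le> p ^ 3"
  shows "\<exists>u. \<forall>k\<in>K. \<not> ((u (a+2) + k (a+2)) mod int p = 0 \<and> (u (a+3) + k (a+3)) mod int p = 0 \<and>
     (u a + k a) mod int p \<noteq> 0 \<and> \<not> QuadRes (int p) (u (a+1) + k (a+1) + (u a + k a)\<^sup>2))"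
proof (cases "\<forall>w\<in>{a+2,a+3} \<rightarrow>\<^sub>E {0..<int p}. \<exists>k\<in>K. \<forall>i\<in>{a+2,a+3}. k i = w i")
  case False
  then obtain w where w: "w \<in> {a+2,a+3} \<rightarrow>\<^sub>E {0..<int p}"
    and none: "\<not> (\<exists>k\<in>K. \<forall>i\<in>{a+2,a+3}. k i = w i)" by meson
  show ?thesis
  proof (intro exI[of _ "\<lambda>i. - w i"] ballI notI, elim conjE)
    fix k assume k: "k \<in> K"
      and *: "(- w (a+2) + k (a+2)) mod int p = 0" "(- w (a+3) + k (a+3)) mod int p = 0"
    have kc: "k \<in> carrier (Fp_space p n)" using k K by (auto simp: Fp_subspace_def)
    have "k i = w i" if "i \<in> {a+2,a+3}" for i
    proof -
      have "(- w i + k i) mod int p = 0" using * that by (elim insertE emptyE) simp_all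
      then have "int p dvd k i - w i" by (simp add: mod_eq_0_iff_dvd)
      then have "k i mod int p = w i mod int p" by (simp add: mod_eq_dvd_iff)
      moreover have "i < n" using that a by auto
      moreover have "w i mod int p = w i" using w that by (auto simp: PiE_iff)
      ultimately show ?thesis using Fp_space_coord(3)[OF kc] by simp
    qed
    then show False using none k by blast
  qed
next
  case True
  define K1 where "K1 = {k \<in> K. \<forall>i\<in>{a+2,a+3}. k i = 0}"
  have K1: "Fp_subspace p n K1" unfolding K1_def by (rule subspace_vanishing[OF K]) (use a in auto)
  have K1c: "K1 \<subseteq> carrier (Fp_space p n)" using K1 by (simp add: Fp_subspace_def)
  have finK1: "finite K1" using K1c finite_Fp_space finite_subset by blast
  have p0: "p > 0" using p prime_gt_0_nat by blast
  have "card K1 * p ^ card {a+2,a+3} \<le> card K"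
    unfolding K1_def by (rule card_vanishing_le[OF K]) (use a True in auto)
  moreover have "card {a+2,a+3} = 2" "p ^ 3 = p * p ^ 2"
    by (simp_all add: power3_eq_cube power2_eq_square)
  ultimately have "card K1 * p ^ 2 \<le> p * p ^ 2" using card by (metis le_trans)
  then have cK1: "card K1 \<le> p" using p0 by (metis mult_le_cancel2 zero_less_power)
  show ?thesis
  proof (cases "\<forall>k\<in>K1. k a = 0")
    case True
    show ?thesis
    proof (intro exI[of _ "\<lambda>i. 0"] ballI notI, elim conjE)
      fix k assume k: "k \<in> K"
        and *: "(0 + k (a+2)) mod int p = 0" "(0 + k (a+3)) mod int p = 0" "(0 + k a) mod int p \<noteq> 0"
      have kc: "k \<in> carrier (Fp_space p n)" using k K by (auto simp: Fp_subspace_def)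
      have "k (a+2) = 0" "k (a+3) = 0"
        using *(1,2) Fp_space_coord(3)[OF kc, of "a+2"] Fp_space_coord(3)[OF kc, of "a+3"] a by simp_all
      then have "k \<in> K1" using k by (simp add: K1_def)
      then have "k a = 0" using True by blast
      then show False using *(3) by simp
    qed
  next
    case False
    then obtain d where d: "d \<in> K1" "d a \<noteq> 0" by blast
    have dc: "d \<in> carrier (Fp_space p n)" using d K1c by blast
    have cop: "coprime (d a) (int p)"
    proof -
      have "\<not> int p dvd d a"
        using d(2) Fp_space_coord[OF dc, of a] a using zdvd_not_zless[of "d a" "int p"] by force
      then show ?thesis using p(1) by (simp add: prime_imp_coprime coprime_commute)
    qed
    let ?l = "\<lambda>t. t \<odot>\<^bsub>Fp_space p n\<^esub> d"
    have inj: "inj_on ?l {0..<int p}"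
    proof (rule inj_onI)
      fix t t' assume t: "t \<in> {0..<int p}" "t' \<in> {0..<int p}" "?l t = ?l t'"
      have "(t * d a) mod int p = (t' * d a) mod int p"
        using fun_cong[OF t(3), of a] a by (simp add: smult_Fp_space)
      then have "[t * d a = t' * d a] (mod int p)" by (simp add: unique_euclidean_semiring_class.cong_def)
      then have "[t = t'] (mod int p)" using cop by (simp add: cong_mult_rcancel)
      then show "t = t'" using t by (simp add: unique_euclidean_semiring_class.cong_def)
    qed
    have "?l ` {0..<int p} = K1"
    proof (rule card_seteq[OF finK1])
      show "?l ` {0..<int p} \<subseteq> K1" using K1 d by (auto simp: Fp_subspace_def)
      show "card K1 \<le> card (?l ` {0..<int p})" using cK1 inj by (simp add: card_image)
    qed
    then have line: "\<exists>t. k = ?l t" if "k \<in> K1" for k using that by blast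
    have "coprime (2 * d a) (int p)" using cop p(2) by simp
    then obtain e where e: "[2 * d a * e = 1] (mod int p)" using cong_solve_coprime_int by blast
    define f where "f = e * d (a+1)"
    have f: "[2 * d a * f = d (a+1)] (mod int p)"
      using cong_mult[OF e cong_refl[of "d (a+1)"]] by (simp add: f_def mult.assoc)
    show ?thesis
    proof (intro exI[of _ "\<lambda>i. if i = a+1 then f\<^sup>2 else 0"] ballI notI, elim conjE)
      let ?u = "\<lambda>i. if i = a+1 then f\<^sup>2 else 0"
      fix k assume k: "k \<in> K"
        and *: "(?u (a+2) + k (a+2)) mod int p = 0" "(?u (a+3) + k (a+3)) mod int p = 0"
        and nr: "\<not> QuadRes (int p) (?u (a+1) + k (a+1) + (?u a + k a)\<^sup>2)"
      have kc: "k \<in> carrier (Fp_space p n)" using k K by (auto simp: Fp_subspace_def)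
      have "k (a+2) = 0" "k (a+3) = 0"
        using *(1,2) Fp_space_coord(3)[OF kc, of "a+2"] Fp_space_coord(3)[OF kc, of "a+3"] a by simp_all
      then have "k \<in> K1" using k by (simp add: K1_def)
      then obtain t where t: "k = ?l t" using line by blast
      have ka: "[k a = t * d a] (mod int p)" "[k (a+1) = t * d (a+1)] (mod int p)"
        using t a by (auto simp: smult_Fp_space)
      have "[k (a+1) = t * (2 * d a * f)] (mod int p)"
        using cong_trans[OF ka(2) cong_mult[OF cong_refl cong_sym[OF f]]] .
      then have "[f\<^sup>2 + k (a+1) + (k a)\<^sup>2 = f\<^sup>2 + t * (2 * d a * f) + (t * d a)\<^sup>2] (mod int p)"
        using ka(1) by (intro cong_add cong_pow cong_refl)
      also have "f\<^sup>2 + t * (2 * d a * f) + (t * d a)\<^sup>2 = (f + t * d a)\<^sup>2"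
        by (simp add: power2_eq_square algebra_simps)
      finally have sq: "[(f + t * d a)\<^sup>2 = f\<^sup>2 + k (a+1) + (k a)\<^sup>2] (mod int p)"
        by (rule cong_sym)
      have "QuadRes (int p) (f\<^sup>2 + k (a+1) + (k a)\<^sup>2)"
        unfolding QuadRes_def using sq by blast
      then show False using nr by simp
    qed
  qed
qed

text \<open>
  If \<open>K\<close> does not project onto the first \<open>s\<close> coordinates, some translate never vanishes on
  them. Otherwise only the at most \<open>p ^ 3\<close> vectors of \<open>K\<close> vanishing there matter, and since the
  blocks are disjoint sets of coordinates the shifts of the individual blocks can be combined into one vector.
  That a single translate defeats every block at once is what lets the mean grow with the number
  of blocks.
\<close>

lemma ex_translate_avoiding_nonresidue_set:
  assumes p: "prime p" "odd p" and le: "s + 4 * N \<le> n"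
    and K: "Fp_subspace p n K" and card: "card K \<le> p ^ (s + 3)"
  shows "\<exists>v\<in>carrier (Fp_space p n). \<forall>k\<in>K. v \<oplus>\<^bsub>Fp_space p n\<^esub> k \<notin> nonresidue_set p n s N"
proof (cases "\<forall>w\<in>{..<s} \<rightarrow>\<^sub>E {0..<int p}. \<exists>k\<in>K. \<forall>i\<in>{..<s}. k i = w i")
  case False
  have p0: "p > 0" using p prime_gt_0_nat by blast
  from False obtain w where w: "w \<in> {..<s} \<rightarrow>\<^sub>E {0..<int p}"
    and none: "\<not> (\<exists>k\<in>K. \<forall>i\<in>{..<s}. k i = w i)" by meson
  define v where "v = (\<lambda>i\<in>{..<n}. if i < s then (- w i) mod int p else 0)"
  show ?thesis
  proof (intro bexI[of _ v] ballI notI)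
    show "v \<in> carrier (Fp_space p n)" using p0 by (auto simp: v_def carrier_Fp_space)
    fix k assume k: "k \<in> K" and bad: "v \<oplus>\<^bsub>Fp_space p n\<^esub> k \<in> nonresidue_set p n s N"
    have kc: "k \<in> carrier (Fp_space p n)" using k K by (auto simp: Fp_subspace_def)
    have "k i = w i" if i: "i < s" for i
    proof -
      have "i < n" using i le by simp
      have "(v \<oplus>\<^bsub>Fp_space p n\<^esub> k) i = 0" using bad i by (auto simp: nonresidue_set_def nonresidue_piece_def)
      then have "(- w i + k i) mod int p = 0"
        using i \<open>i < n\<close> by (simp add: add_Fp_space v_def mod_simps)
      then have "int p dvd k i - w i" by (simp add: mod_eq_0_iff_dvd)
      then have "k i mod int p = w i mod int p" by (simp add: mod_eq_dvd_iff)
      moreover have "w i mod int p = w i" using w i by (auto simp: PiE_iff)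
      ultimately show ?thesis using Fp_space_coord(3)[OF kc \<open>i < n\<close>] by simp
    qed
    then show False using none k by blast
  qed
next
  case True
  have p0: "p > 0" using p prime_gt_0_nat by blast
  define K0 where "K0 = {k \<in> K. \<forall>i\<in>{..<s}. k i = 0}"
  have K0: "Fp_subspace p n K0" unfolding K0_def by (rule subspace_vanishing[OF K]) (use le in auto)
  have "card K0 * p ^ card {..<s} \<le> card K"
    unfolding K0_def by (rule card_vanishing_le[OF K]) (use le True in auto)
  moreover have "card {..<s} = s" "p ^ (s + 3) = p ^ 3 * p ^ s"
    by (simp_all add: power_add mult.commute)
  ultimately have "card K0 * p ^ s \<le> p ^ 3 * p ^ s" using card by (metis le_trans)
  then have cK0: "card K0 \<le> p ^ 3" using p0 by (metis mult_le_cancel2 zero_less_power)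
  define Q where "Q j u k \<longleftrightarrow> (u (s+4*j+2) + k (s+4*j+2)) mod int p = 0 \<and>
      (u (s+4*j+3) + k (s+4*j+3)) mod int p = 0 \<and>
      (u (s+4*j) + k (s+4*j)) mod int p \<noteq> 0 \<and>
      \<not> QuadRes (int p) (u (s+4*j+1) + k (s+4*j+1) + (u (s+4*j) + k (s+4*j))\<^sup>2)"
    for j :: nat and u k :: "nat \<Rightarrow> int"
  have "\<exists>u. \<forall>k\<in>K0. \<not> Q j u k" if "j < N" for j
    unfolding Q_def by (rule ex_shift_avoiding_nonresidues[OF p _ K0 cK0]) (use that le in linarith)
  then have "\<forall>j. \<exists>u. j < N \<longrightarrow> (\<forall>k\<in>K0. \<not> Q j u k)" by blast
  from choice[OF this] obtain u where u: "\<And>j k. j < N \<Longrightarrow> k \<in> K0 \<Longrightarrow> \<not> Q j (u j) k"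
    by blast
  \<comment> \<open>coordinate \<open>i \<ge> s\<close> belongs to block number \<open>(i - s) div 4\<close>\<close>
  define v where "v = (\<lambda>i\<in>{..<n}. if i < s then 0 else u ((i - s) div 4) i mod int p)"
  have vi: "v (s+4*j+e) = u j (s+4*j+e) mod int p" if "j < N" "e < 4" for j e
    using that le by (simp add: v_def)
  show ?thesis
  proof (intro bexI[of _ v] ballI notI)
    show "v \<in> carrier (Fp_space p n)" using p0 by (auto simp: v_def carrier_Fp_space)
    fix k assume k: "k \<in> K" and bad: "v \<oplus>\<^bsub>Fp_space p n\<^esub> k \<in> nonresidue_set p n s N"
    have kc: "k \<in> carrier (Fp_space p n)" using k K by (auto simp: Fp_subspace_def)
    let ?x = "v \<oplus>\<^bsub>Fp_space p n\<^esub> k"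
    from bad obtain j where j: "j < N" and bj: "?x \<in> nonresidue_piece p n s (s+4*j)"
      by (auto simp: nonresidue_set_def)
    have "k i = 0" if i: "i < s" for i
    proof -
      have "i < n" using i le by simp
      have "?x i = 0" using bj i by (auto simp: nonresidue_piece_def)
      then have "k i mod int p = 0" using i \<open>i < n\<close> by (simp add: add_Fp_space v_def)
      then show ?thesis using Fp_space_coord(3)[OF kc \<open>i < n\<close>] by simp
    qed
    then have kK0: "k \<in> K0" using k by (simp add: K0_def)
    have xe: "?x (s+4*j+e) = (u j (s+4*j+e) + k (s+4*j+e)) mod int p" if "e < 4" for e
      using vi[OF j that] that j le by (simp add: add_Fp_space mod_simps)
    note x = xe[of 0, simplified] xe[of 1] xe[of 2] xe[of 3]
    have "[?x (s+4*j+1) + (?x (s+4*j))\<^sup>2 =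
        u j (s+4*j+1) + k (s+4*j+1) + (u j (s+4*j) + k (s+4*j))\<^sup>2] (mod int p)"
      using x by (intro cong_add cong_pow) auto
    then have "QuadRes (int p) (?x (s+4*j+1) + (?x (s+4*j))\<^sup>2) \<longleftrightarrow>
        QuadRes (int p) (u j (s+4*j+1) + k (s+4*j+1) + (u j (s+4*j) + k (s+4*j))\<^sup>2)"
      unfolding QuadRes_def by (meson cong_trans cong_sym)
    then have "Q j (u j) k" using bj x by (simp add: nonresidue_piece_def Q_def)
    then show False using u[OF j kK0] by simp
  qed
qed

text \<open>
  For a surjective map the kernel has at most \<open>p ^ r\<close> elements, and the nonempty fibers are the
  intersections with translates of the kernel; one translate is avoided by the preceding lemma.
\<close>

lemma all_maps_miss_nonresidue_set:
  assumes p: "prime p" "odd p" and r: "r \<ge> 3" "r \<le> n" and N: "4 * N \<le> n - r + 3"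
  shows "all_maps_miss p n (n - r) (nonresidue_set p n (r - 3) N)"
  unfolding all_maps_miss_def
proof
  fix L assume L: "L \<in> Fp_linear_maps p n (n - r)"
  let ?b = "n - r" and ?V = "Fp_space p n" and ?W = "Fp_space p (n - r)"
  let ?B = "nonresidue_set p n (r - 3) N"
  have p0: "p > 0" using p prime_gt_0_nat by blast
  have BV: "?B \<subseteq> carrier ?V" by (auto simp: nonresidue_set_def nonresidue_piece_def)
  note Lc = Fp_linear_mapsD(1)[OF L] and lin = Fp_linear_mapsD(2)[OF L]
    and closed = Fp_space_closed[OF p0]
  show "\<exists>y\<in>carrier ?W. fiber L ?B y = {}"
  proof (cases "carrier ?W \<subseteq> L ` carrier ?V")
    case False
    then obtain y where "y \<in> carrier ?W" "y \<notin> L ` carrier ?V" by blast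
    moreover from this have "fiber L ?B y = {}" using BV unfolding fiber_def by blast
    ultimately show ?thesis by blast
  next
    case True
    define K where "K = {k \<in> carrier ?V. L k = \<zero>\<^bsub>?W\<^esub>}"
    have K: "Fp_subspace p n K" unfolding K_def by (rule kernel_subspace[OF L p0])
    have "card K * card (carrier ?W) \<le> card (carrier ?V)"
    proof (rule card_kernel_le[where f = L and pl = "add ?V"])
      show "finite (carrier ?V)" by (rule finite_Fp_space)
      show "carrier ?W \<subseteq> L ` carrier ?V" by (rule True)
      show "k = k'" if "k \<in> K" "k' \<in> K" "k \<oplus>\<^bsub>?V\<^esub> z = k' \<oplus>\<^bsub>?V\<^esub> z" for k k' z
        using Fp_space_add_cancel[OF _ _ that(3)] that(1,2) unfolding K_def by blast
    next
      fix k z assume kz: "k \<in> K" "z \<in> carrier ?V"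
      show "k \<oplus>\<^bsub>?V\<^esub> z \<in> carrier ?V" by (rule closed)
      show "L (k \<oplus>\<^bsub>?V\<^esub> z) = L z" 
        using kz lin[of k z] Fp_space_zero_add[OF p0 Lc[of z]] by (simp add: K_def)
    qed
    then have "card K * p ^ ?b \<le> p ^ n" by (simp only: card_Fp_space)
    moreover have "p ^ n = p ^ (r - 3 + 3) * p ^ ?b" using r by (simp flip: power_add)
    ultimately have "card K \<le> p ^ (r - 3 + 3)" using p0 by (metis mult_le_cancel2 zero_less_power)
    moreover have "r - 3 + 4 * N \<le> n" using N r by linarith
    ultimately obtain v where v: "v \<in> carrier ?V" and miss: "\<And>k. k \<in> K \<Longrightarrow> v \<oplus>\<^bsub>?V\<^esub> k \<notin> ?B"
      using ex_translate_avoiding_nonresidue_set[OF p _ K] by blast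
    have "fiber L ?B (L v) = {}"
    proof (rule ccontr)
      assume "fiber L ?B (L v) \<noteq> {}"
      then obtain x where x: "x \<in> ?B" "L x = L v" by (auto simp: fiber_def)
      have xV: "x \<in> carrier ?V" using x BV by blast
      define k where "k = (\<lambda>i\<in>{..<n}. (x i - v i) mod int p)"
      have kV: "k \<in> carrier ?V" using p0 by (simp add: k_def carrier_Fp_space restrict_PiE_iff)
      have vk: "v \<oplus>\<^bsub>?V\<^esub> k = x"
        by (rule Fp_space_ext[OF closed(1) xV])
          (simp add: add_Fp_space k_def mod_add_right_eq Fp_space_coord(3)[OF xV])
      have kv: "k \<oplus>\<^bsub>?V\<^esub> v = v \<oplus>\<^bsub>?V\<^esub> k" by (simp add: add_Fp_space add.commute)
      have "L k \<oplus>\<^bsub>?W\<^esub> L v = \<zero>\<^bsub>?W\<^esub> \<oplus>\<^bsub>?W\<^esub> L v"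
        using lin[OF kV v] kv vk x(2) Fp_space_zero_add[OF p0 Lc[OF v]] by simp
      then have "L k = \<zero>\<^bsub>?W\<^esub>" by (rule Fp_space_add_cancel[OF Lc[OF kV] closed(3)])
      then have "k \<in> K" using kV by (simp add: K_def)
      then show False using miss vk x(1) by metis
    qed
    then show ?thesis using Lc v by blast
  qed
qed

lemma all_maps_miss_mono:
  assumes "all_maps_miss p n b S" "S' \<subseteq> S"
  shows "all_maps_miss p n b S'"
proof -
  have "fiber L S' y = {}" if "fiber L S y = {}" for L y
    using assms(2) that by (auto simp: fiber_def)
  then show ?thesis using assms(1) unfolding all_maps_miss_def by meson
qed

section \<open>The size of the set\<close>

text \<open>
  A crude Bonferroni inequality; the pairwise intersections of the pieces are so small that the
  quadratic error is negligible.
\<close>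

lemma sum_card_le_card_UN_add:
  fixes A :: "nat \<Rightarrow> 'a set"
  assumes fin: "\<And>j. j < N \<Longrightarrow> finite (A j)"
    and inter: "\<And>i j. i < j \<Longrightarrow> j < N \<Longrightarrow> card (A i \<inter> A j) \<le> M"
  shows "(\<Sum>j<N. card (A j)) \<le> card (\<Union>j<N. A j) + M * N\<^sup>2"
  using assms
proof (induction N)
  case (Suc N)
  let ?U = "\<Union>j<N. A j"
  have "card (?U \<inter> A N) = card (\<Union>j<N. A j \<inter> A N)" by (rule arg_cong[where f = card]) blast
  also have "\<dots> \<le> (\<Sum>j<N. card (A j \<inter> A N))" by (rule card_UN_le) simp
  also have "\<dots> \<le> (\<Sum>j<N. M)" by (rule sum_mono) (use Suc.prems in auto)
  finally have i: "card (?U \<inter> A N) \<le> N * M" by simp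
  have "card ?U + card (A N) = card (?U \<union> A N) + card (?U \<inter> A N)"
    by (rule card_Un_Int) (use Suc.prems in auto)
  moreover have "(\<Sum>j<N. card (A j)) \<le> card ?U + M * N\<^sup>2" using Suc by auto
  moreover have "(\<Union>j<Suc N. A j) = ?U \<union> A N" by (auto simp: less_Suc_eq)
  ultimately have "(\<Sum>j<Suc N. card (A j)) \<le> card (\<Union>j<Suc N. A j) + N * M + M * N\<^sup>2"
    using i by simp
  also have "\<dots> \<le> card (\<Union>j<Suc N. A j) + M * (Suc N)\<^sup>2"
    by (simp add: power2_eq_square algebra_simps)
  finally show ?case .
qed simp

text \<open>
  Modulo \<open>p\<close>, every square is the square of one of the \<open>(p + 1) / 2\<close> integers
  \<open>0, \<dots>, (p - 1) / 2\<close>, which bounds the number of squares from above.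
\<close>

lemma card_nonresidue_shift:
  assumes "odd p"
  shows "(p - 1) div 2 \<le> card {y \<in> {0..<int p}. \<not> QuadRes (int p) (y + c)}"
proof -
  let ?Z = "{0..<int p}" and ?h = "(int p - 1) div 2"
  let ?Q = "{y \<in> ?Z. QuadRes (int p) (y + c)}"
  have p0: "p > 0" using assms odd_pos by blast
  have "?Q \<subseteq> (\<lambda>z. (z\<^sup>2 - c) mod int p) ` {0..?h}"
  proof
    fix y assume y: "y \<in> ?Q"
    then obtain z where z: "[z\<^sup>2 = y + c] (mod int p)" by (auto simp: QuadRes_def)
    define z1 where "z1 = z mod int p"
    have z1: "0 \<le> z1" "z1 < int p" "[z1 = z] (mod int p)" using p0 by (auto simp: z1_def)
    \<comment> \<open>negate the root if necessary, to bring it into the lower half of the residues\<close>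
    define z2 where "z2 = (if z1 \<le> ?h then z1 else int p - z1)"
    have z2: "z2 \<in> {0..?h}" using z1 assms by (auto simp: z2_def elim!: oddE)
    have "[z2\<^sup>2 = z1\<^sup>2] (mod int p)"
    proof (cases "z1 \<le> ?h")
      case False
      have "z2\<^sup>2 - z1\<^sup>2 = int p * (int p - 2 * z1)"
        using False by (simp add: z2_def power2_eq_square algebra_simps)
      then show ?thesis by (simp add: cong_iff_dvd_diff)
    qed (simp add: z2_def)
    then have "[z2\<^sup>2 = y + c] (mod int p)"
      using cong_trans[OF cong_pow[OF z1(3)] z] by (rule cong_trans)
    then have "[z2\<^sup>2 - c = y + c - c] (mod int p)" by (rule cong_diff) (rule cong_refl)
    then have "[z2\<^sup>2 - c = y] (mod int p)" by simp
    then have "(z2\<^sup>2 - c) mod int p = y" using y by (simp add: unique_euclidean_semiring_class.cong_def)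
    then show "y \<in> (\<lambda>z. (z\<^sup>2 - c) mod int p) ` {0..?h}" using z2 by force
  qed
  then have "card ?Q \<le> card {0..?h}" by (rule surj_card_le[rotated]) simp
  then have "card ?Q \<le> (p + 1) div 2" using assms by (auto elim!: oddE)
  moreover have "card ?Z = card ?Q + card {y \<in> ?Z. \<not> QuadRes (int p) (y + c)}"
  proof (subst card_Un_disjoint[symmetric])
    show "finite ?Q" "finite {y \<in> ?Z. \<not> QuadRes (int p) (y + c)}"
      by (rule finite_subset[of _ ?Z]; blast?; simp)+
    show "card ?Z = card (?Q \<union> {y \<in> ?Z. \<not> QuadRes (int p) (y + c)})"
      by (rule arg_cong[where f = card]) blast
  qed blast
  ultimately show ?thesis using assms by (auto elim!: oddE)
qed

text \<open>
  Fixing the first entry \<open>t\<close> of the block turns the piece into a product set, with at least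
  \<open>(p - 1) / 2\<close> choices for the second entry and \<open>p\<close> for each coordinate outside the block and the
  first \<open>s\<close>.
\<close>

lemma card_nonresidue_piece_ge:
  assumes "odd p" and a: "s \<le> a" "a + 4 \<le> n"
  shows "(p - 1) * ((p - 1) div 2) * p ^ (n - s - 4) \<le> card (nonresidue_piece p n s a)"
proof -
  have p0: "p > 0" using assms odd_pos by blast
  let ?Z = "{0..<int p}"
  define Y where "Y t = {y \<in> ?Z. \<not> QuadRes (int p) (y + t\<^sup>2)}" for t
  define R where "R = {s..<n} - {a..<a+4}"
  define B where "B t i = (if i = a then {t} else if i = a + 1 then Y t else if i \<in> R then ?Z else {0})"
    for t :: int and i :: nat
  have R: "finite R" "card R = n - s - 4" "a \<notin> R" "a + 1 \<notin> R" "R \<subseteq> {..<n}"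
    using a by (auto simp: R_def card_Diff_subset)
  have finY: "finite (Y t)" for t unfolding Y_def by (rule finite_subset[of _ ?Z]) auto
  have finB: "finite (PiE {..<n} (B t))" for t
    by (rule finite_PiE) (simp_all add: B_def finY)
  have "(p - 1) div 2 * p ^ (n - s - 4) \<le> card (PiE {..<n} (B t))" for t
  proof -
    have "card (PiE {..<n} (B t)) = (\<Prod>i<n. card (B t i))" by (simp add: card_PiE)
    also have "\<dots> = (\<Prod>i\<in>insert (a+1) R. card (B t i))"
      by (rule prod.mono_neutral_right) (use R a in \<open>auto simp: B_def\<close>)
    also have "\<dots> = card (Y t) * (\<Prod>i\<in>R. card (B t i))" using R by (simp add: B_def)
    also have "(\<Prod>i\<in>R. card (B t i)) = (\<Prod>i\<in>R. p)"
      by (rule prod.cong) (use R in \<open>auto simp: B_def\<close>)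
    also have "\<dots> = p ^ (n - s - 4)" using R by simp
    finally show ?thesis using card_nonresidue_shift[OF assms(1), of "t\<^sup>2"] by (simp add: Y_def)
  qed
  then have "(\<Sum>t\<in>{1..<int p}. (p - 1) div 2 * p ^ (n - s - 4)) \<le> (\<Sum>t\<in>{1..<int p}. card (PiE {..<n} (B t)))"
    by (rule sum_mono)
  also have "\<dots> = card (\<Union>t\<in>{1..<int p}. PiE {..<n} (B t))"
  proof (rule card_UN_disjoint[symmetric])
    show "\<forall>i\<in>{1..<int p}. \<forall>j\<in>{1..<int p}. i \<noteq> j \<longrightarrow> PiE {..<n} (B i) \<inter> PiE {..<n} (B j) = {}"
    proof (intro ballI impI equals0I)
      fix i j x assume "i \<noteq> j" "x \<in> PiE {..<n} (B i) \<inter> PiE {..<n} (B j)"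
      then have "x a \<in> B i a" "x a \<in> B j a" using a by (auto simp: PiE_iff)
      then show False using \<open>i \<noteq> j\<close> by (simp add: B_def)
    qed
  qed (use finB in auto)
  also have "\<dots> \<le> card (nonresidue_piece p n s a)"
  proof (rule card_mono)
    show "finite (nonresidue_piece p n s a)" using finite_Fp_space by (auto simp: nonresidue_piece_def)
    show "(\<Union>t\<in>{1..<int p}. PiE {..<n} (B t)) \<subseteq> nonresidue_piece p n s a"
    proof (intro UN_least subsetI)
      fix t x assume t: "t \<in> {1..<int p}" and x: "x \<in> PiE {..<n} (B t)"
      have xi: "x i \<in> B t i" if "i < n" for i using x that by (auto simp: PiE_iff)
      have "B t i \<subseteq> ?Z" for i using t p0 by (auto simp: B_def Y_def)
      then have "x \<in> carrier (Fp_space p n)" using x by (fastforce simp: carrier_Fp_space PiE_iff)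
      moreover have "x a = t" "x (a+1) \<in> Y t" using xi[of a] xi[of "a+1"] a by (auto simp: B_def)
      moreover have "x i = 0" if "i < s" for i using xi[of i] that a by (auto simp: B_def R_def)
      moreover have "x (a+2) = 0" "x (a+3) = 0" using xi[of "a+2"] xi[of "a+3"] a by (auto simp: B_def R_def)
      ultimately show "x \<in> nonresidue_piece p n s a" using t by (auto simp: nonresidue_piece_def Y_def)
    qed
  qed
  finally have "nat (int p - 1) * ((p - 1) div 2 * p ^ (n - s - 4)) \<le> card (nonresidue_piece p n s a)"
    by simp
  moreover have "nat (int p - 1) = p - 1" using p0 by linarith
  ultimately show ?thesis by (simp only: mult.assoc)
qed

lemma card_nonresidue_piece_Int_le:
  assumes "s \<le> a" "a + 4 \<le> a'" "a' + 4 \<le> n"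
  shows "card (nonresidue_piece p n s a \<inter> nonresidue_piece p n s a') \<le> p ^ (n - s - 4)"
proof -
  let ?I = "{..<s} \<union> {a+2, a+3, a'+2, a'+3}"
  define B where "B i = (if i \<in> ?I then {0} else {0..<int p})" for i
  have I: "?I \<subseteq> {..<n}" "card ?I = s + 4" using assms by (auto simp: card_Un_disjoint)
  have "nonresidue_piece p n s a \<inter> nonresidue_piece p n s a' \<subseteq> PiE {..<n} B"
    
  proof
    fix x assume x: "x \<in> nonresidue_piece p n s a \<inter> nonresidue_piece p n s a'"
    then have xV: "x \<in> {..<n} \<rightarrow>\<^sub>E {0..<int p}" by (simp add: nonresidue_piece_def carrier_Fp_space)
    show "x \<in> PiE {..<n} B"
    proof (rule PiE_I)
      show "x i \<in> B i" if "i \<in> {..<n}" for i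
        using x PiE_mem[OF xV that] by (auto simp: B_def nonresidue_piece_def)
      show "x i = undefined" if "i \<notin> {..<n}" for i using PiE_arb[OF xV that] .
    qed
  qed
  then have "card (nonresidue_piece p n s a \<inter> nonresidue_piece p n s a') \<le> card (PiE {..<n} B)"
    by (intro card_mono finite_PiE) (auto simp: B_def)
  also have "\<dots> = (\<Prod>i<n. card (B i))" by (simp add: card_PiE)
  also have "\<dots> = (\<Prod>i\<in>{..<n} - ?I. card (B i))"
    by (rule prod.mono_neutral_right) (auto simp: B_def)
  also have "\<dots> = (\<Prod>i\<in>{..<n} - ?I. p)" by (rule prod.cong) (auto simp: B_def)
  also have "\<dots> = p ^ (n - s - 4)" using I by (simp add: card_Diff_subset)
  finally show ?thesis .
qed

lemma card_nonresidue_set_ge: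
  assumes "odd p" and N: "s + 4 * N \<le> n"
  shows "N * ((p - 1) * ((p - 1) div 2)) * p ^ (n - s - 4) \<le> card (nonresidue_set p n s N) + N\<^sup>2 * p ^ (n - s - 4)"
proof -
  have "N * ((p - 1) * ((p - 1) div 2)) * p ^ (n - s - 4) =
      (\<Sum>j<N. (p - 1) * ((p - 1) div 2) * p ^ (n - s - 4))" by simp
  also have "\<dots> \<le> (\<Sum>j<N. card (nonresidue_piece p n s (s + 4 * j)))"
    by (rule sum_mono) (use card_nonresidue_piece_ge[OF assms(1)] N in auto)
  also have "\<dots> \<le> card (nonresidue_set p n s N) + p ^ (n - s - 4) * N\<^sup>2"
    unfolding nonresidue_set_def
  proof (rule sum_card_le_card_UN_add)
    show "finite (nonresidue_piece p n s (s + 4 * j))" for j using finite_Fp_space by (auto simp: nonresidue_piece_def)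
    show "card (nonresidue_piece p n s (s + 4 * i) \<inter> nonresidue_piece p n s (s + 4 * j)) \<le> p ^ (n - s - 4)"
      if "i < j" "j < N" for i j by (rule card_nonresidue_piece_Int_le) (use that N in auto)
  qed
  finally show ?thesis by (simp add: mult.commute)
qed

lemma div10_bounds:
  "real m / 10 - 1 \<le> real (m div 10)" "real (m div 10) \<le> real m / 10"
proof -
  have "real m = 10 * real (m div 10) + real (m mod 10)"
    by (metis mult_div_mod_eq of_nat_add of_nat_mult of_nat_numeral)
  moreover have "m mod 10 < 10" by simp
  then have "real (m mod 10) < 10" by linarith
  ultimately show "real m / 10 - 1 \<le> real (m div 10)" "real (m div 10) \<le> real m / 10"
    by linarith+
qed

text \<open>
  With \<open>N\<close> blocks, where \<open>N\<close> is about \<open>n / 4\<close>, the mean fiber is about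
  \<open>N (p\<^sup>2 / 2) / p\<close>, that is \<open>n p / 8\<close>. The slack between \<open>1 / 8\<close> and \<open>1 / 10\<close> absorbs the loss
  of \<open>r \<le> n / 10\<close> coordinates and the lower-order terms:
  \<open>N \<ge> 9 n / 40\<close>, and \<open>(9 / 40) (4 / 9) = 1 / 10\<close>.
\<close>

lemma card_nonresidue_set_large:
  assumes p: "odd p" and r: "3 \<le> r" "10 * r \<le> n" and n: "0 < n"
    and big: "4 / 9 * (real p)\<^sup>2 \<le> (real p - 1)\<^sup>2 / 2 - real n"
  shows "p ^ (n - r) * (n * p div 10) \<le> card (nonresidue_set p n (r - 3) ((n - r + 3) div 4))"
proof -
  define b where "b = n - r"
  define N where "N = (b + 3) div 4"
  let ?B = "nonresidue_set p n (r - 3) N"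
  have p1: "p \<ge> 1" using p odd_pos by fastforce
  have b: "1 \<le> b" "b + r = n" "n - (r - 3) - 4 = b - 1" using r n by (auto simp: b_def)
  have N: "4 * N \<le> b + 3" "b \<le> 4 * N" unfolding N_def by linarith+
  have Nr: "9 / 40 * real n \<le> real N" "real N \<le> real n" using N r b by linarith+
  have "r - 3 + 4 * N \<le> n" using N b r by linarith
  from card_nonresidue_set_ge[OF p this]
  have "N * ((p - 1) * ((p - 1) div 2)) * p ^ (b - 1) \<le> card ?B + N\<^sup>2 * p ^ (b - 1)"
    by (simp only: b)
  then have "real (N * ((p - 1) * ((p - 1) div 2)) * p ^ (b - 1)) \<le> real (card ?B + N\<^sup>2 * p ^ (b - 1))"
    by (rule of_nat_mono)
  moreover have half: "real ((p - 1) div 2) = (real p - 1) / 2" using p by (auto elim!: oddE)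
  moreover have "real (p - 1) = real p - 1" using p1 by simp
  ultimately have "real N * ((real p - 1) * ((real p - 1) / 2)) * real p ^ (b - 1)
      \<le> real (card ?B) + (real N)\<^sup>2 * real p ^ (b - 1)"
    by (simp only: of_nat_mult of_nat_power of_nat_add)
  then have low: "(real N * ((real p - 1)\<^sup>2 / 2) - (real N)\<^sup>2) * real p ^ (b - 1) \<le> real (card ?B)"
    unfolding left_diff_distrib power2_eq_square[of "real p - 1"] times_divide_eq_right by linarith
  \<comment> \<open>as \<open>N \<le> n\<close>, the Bonferroni error \<open>N\<^sup>2\<close> is at most \<open>N n\<close>\<close>
  have "real n / 10 * (real p)\<^sup>2 = 9 / 40 * real n * (4 / 9 * (real p)\<^sup>2)" by simp
  also have "\<dots> \<le> real N * ((real p - 1)\<^sup>2 / 2 - real n)"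
    by (rule mult_mono) (use Nr big in auto)
  also have "\<dots> \<le> real N * ((real p - 1)\<^sup>2 / 2 - real N)"
    by (rule mult_left_mono) (use Nr in auto)
  also have "\<dots> = real N * ((real p - 1)\<^sup>2 / 2) - (real N)\<^sup>2"
    by (simp add: power2_eq_square right_diff_distrib)
  finally have main: "real n / 10 * (real p)\<^sup>2 \<le> real N * ((real p - 1)\<^sup>2 / 2) - (real N)\<^sup>2" .
  have "real (p ^ b * (n * p div 10)) \<le> real p ^ b * (real n * real p / 10)"
    unfolding of_nat_mult of_nat_power
    by (rule mult_left_mono) (use div10_bounds(2)[of "n * p"] in simp_all)
  also have "real p ^ b = real p * real p ^ (b - 1)" using b(1) by (cases b) auto
  also have "real p * real p ^ (b - 1) * (real n * real p / 10) = real n / 10 * (real p)\<^sup>2 * real p ^ (b - 1)"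
    by (simp add: power2_eq_square)
  also have "\<dots> \<le> (real N * ((real p - 1)\<^sup>2 / 2) - (real N)\<^sup>2) * real p ^ (b - 1)"
    by (rule mult_right_mono[OF main]) simp
  also note low
  finally have "p ^ b * (n * p div 10) \<le> card ?B" by linarith
  then show ?thesis by (simp only: N_def b_def)
qed

text \<open>
  The property of being missed passes to subsets, so the cardinality can be prescribed; a multiple
  of \<open>p ^ (n - r)\<close> makes the mean fiber an integer.
\<close>

lemma ex_missed_set:
  assumes p: "prime p" "odd p" and r: "3 \<le> r" "10 * r \<le> n" and n: "0 < n"
    and big: "4 / 9 * (real p)\<^sup>2 \<le> (real p - 1)\<^sup>2 / 2 - real n"
  shows "\<exists>S \<subseteq> carrier (Fp_space p n). card S = p ^ (n - r) * (n * p div 10) \<and> all_maps_miss p n (n - r) S"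
proof -
  let ?B = "nonresidue_set p n (r - 3) ((n - r + 3) div 4)"
  obtain S where S: "S \<subseteq> ?B" "card S = p ^ (n - r) * (n * p div 10)"
    using obtain_subset_with_card_n[OF card_nonresidue_set_large[OF p(2) r n big]] by metis
  have "4 * ((n - r + 3) div 4) \<le> n - r + 3" "r \<le> n" using r by linarith+
  then have "all_maps_miss p n (n - r) ?B" using p r by (intro all_maps_miss_nonresidue_set)
  then have "all_maps_miss p n (n - r) S" using S(1) by (rule all_maps_miss_mono)
  moreover have "?B \<subseteq> carrier (Fp_space p n)" by (auto simp: nonresidue_set_def nonresidue_piece_def)
  ultimately show ?thesis using S by blast
qed

section \<open>Asymptotics along the primes\<close>

lemma eventually_primes_at_top:
  "eventually P primes_at_top \<longleftrightarrow> (\<forall>\<^sub>F p in at_top. prime p \<longrightarrow> P p)"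
  by (simp add: primes_at_top_def eventually_inf_principal)

lemma primes_at_top_le: "primes_at_top \<le> at_top"
  by (simp add: primes_at_top_def)

lemma primes_at_top_neq_bot: "primes_at_top \<noteq> bot"
proof
  assume "primes_at_top = bot"
  then have "\<forall>\<^sub>F p in at_top. \<not> prime (p :: nat)"
    using eventually_primes_at_top[of "\<lambda>_. False"] by simp
  then obtain N :: nat where "\<And>p. N \<le> p \<Longrightarrow> \<not> prime p" by (auto simp: eventually_at_top_linorder)
  then show False using bigger_prime[of N] by (meson less_imp_le)
qed

lemma eventually_odd_primes_at_top: "\<forall>\<^sub>F p in primes_at_top. prime p \<and> odd p"
  unfolding eventually_primes_at_top
  by (rule eventually_mono[OF eventually_gt_at_top[of 2]]) (use prime_odd_nat in auto)

lemma param_n_bounds: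
  assumes "C\<^sub>0 > 0"
  shows "real p / C\<^sub>0 - 1 < real (param_n C\<^sub>0 p)" "real (param_n C\<^sub>0 p) \<le> real p / C\<^sub>0"
proof -
  have "real (param_n C\<^sub>0 p) = of_int \<lfloor>real p / C\<^sub>0\<rfloor>"
    using assms by (simp add: param_n_def)
  then show "real p / C\<^sub>0 - 1 < real (param_n C\<^sub>0 p)" "real (param_n C\<^sub>0 p) \<le> real p / C\<^sub>0"
    by linarith+
qed

lemma param_r_bounds:
  assumes "c > 0" "p \<ge> 2"
  shows "c * real (param_n C\<^sub>0 p) / ln (real p) \<le> real (param_r C\<^sub>0 c p)"
    "real (param_r C\<^sub>0 c p) < c * real (param_n C\<^sub>0 p) / ln (real p) + 1"
proof -
  have "0 \<le> c * real (param_n C\<^sub>0 p) / ln (real p)" using assms by simp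
  then have "real (param_r C\<^sub>0 c p) = of_int \<lceil>c * real (param_n C\<^sub>0 p) / ln (real p)\<rceil>"
    unfolding param_r_def by simp
  then show "c * real (param_n C\<^sub>0 p) / ln (real p) \<le> real (param_r C\<^sub>0 c p)"
    "real (param_r C\<^sub>0 c p) < c * real (param_n C\<^sub>0 p) / ln (real p) + 1"
    by linarith+
qed

lemma filterlim_param_n:
  assumes "C\<^sub>0 > 0"
  shows "filterlim (param_n C\<^sub>0) at_top at_top"
proof -
  have "filterlim (\<lambda>p. real p / C\<^sub>0 - 1) at_top sequentially" using assms by real_asymp
  then have "filterlim (\<lambda>p. real (param_n C\<^sub>0 p)) at_top sequentially"
    by (rule filterlim_at_top_mono)
      (use param_n_bounds(1)[OF assms] in \<open>auto intro!: always_eventually less_imp_le\<close>)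
  then show ?thesis by (simp add: filterlim_sequentially_iff_filterlim_real)
qed

lemma eventually_params_admissible:
  assumes "C\<^sub>0 > 0" "c > 0"
  shows "\<forall>\<^sub>F p in at_top. 3 \<le> param_r C\<^sub>0 c p \<and> 10 * param_r C\<^sub>0 c p \<le> param_n C\<^sub>0 p \<and>
    4 / 9 * (real p)\<^sup>2 \<le> (real p - 1)\<^sup>2 / 2 - real (param_n C\<^sub>0 p)"
proof -
  have "\<forall>\<^sub>F p::nat in at_top. 3 \<le> c * (real p / C\<^sub>0 - 1) / ln (real p)"
    using assms by real_asymp
  moreover have "\<forall>\<^sub>F p::nat in at_top. c / ln (real p) \<le> 1 / 20" using assms by real_asymp
  moreover have "\<forall>\<^sub>F p::nat in at_top. 20 \<le> real p / C\<^sub>0 - 1" using assms by real_asymp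
  moreover have "\<forall>\<^sub>F p::nat in at_top. 4 / 9 * (real p)\<^sup>2 \<le> (real p - 1)\<^sup>2 / 2 - real p / C\<^sub>0"
    using assms by real_asymp
  ultimately show ?thesis using eventually_ge_at_top[of 2]
  proof eventually_elim
    case (elim p)
    let ?n = "real (param_n C\<^sub>0 p)" and ?r = "real (param_r C\<^sub>0 c p)"
    note n = param_n_bounds[OF assms(1), of p] and r = param_r_bounds[OF assms(2) elim(5), of C\<^sub>0]
    have ln: "ln (real p) > 0" using elim by simp
    have "c * (real p / C\<^sub>0 - 1) / ln (real p) \<le> c * ?n / ln (real p)"
      using n assms ln by (intro divide_right_mono mult_left_mono) auto
    then have "3 \<le> ?r" using elim(1) r by linarith
    moreover have "c / ln (real p) * ?n \<le> 1 / 20 * ?n"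
      by (rule mult_right_mono) (use elim in auto)
    then have "c * ?n / ln (real p) \<le> ?n / 20" by simp
    then have "10 * ?r \<le> ?n" using r n elim(3) by linarith
    ultimately show ?case using elim(4) n by linarith
  qed
qed

lemma eventually_ex_missed_set:
  assumes "C\<^sub>0 > 0" "c > 0"
  shows "\<forall>\<^sub>F p in primes_at_top. \<exists>S \<subseteq> carrier (Fp_space p (param_n C\<^sub>0 p)).
    card S = p ^ param_b C\<^sub>0 c p * (param_n C\<^sub>0 p * p div 10) \<and>
    all_maps_miss p (param_n C\<^sub>0 p) (param_b C\<^sub>0 c p) S"
  using filter_leD[OF primes_at_top_le eventually_params_admissible[OF assms]]
    eventually_odd_primes_at_top
proof eventually_elim
  case (elim p)
  then show ?case unfolding param_b_def by (intro ex_missed_set) auto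
qed

lemma mean_fiber_of_card:
  assumes "card S = p ^ b * m" "p > 0"
  shows "mean_fiber p b S = real m"
  using assms by (simp add: mean_fiber_def)

lemma mean_equiv:
  assumes "C\<^sub>0 > 0"
  shows "(\<lambda>p. real (param_n C\<^sub>0 p * p div 10)) \<sim>[at_top] (\<lambda>p. (real p)\<^sup>2 / (10 * C\<^sub>0))"
    and "(\<lambda>p. real (param_n C\<^sub>0 p) * real p / 10) \<sim>[at_top] (\<lambda>p. (real p)\<^sup>2 / (10 * C\<^sub>0))"
proof -
  have close: "\<bar>real (param_n C\<^sub>0 p) * real p / 10 - (real p)\<^sup>2 / (10 * C\<^sub>0)\<bar> \<le> real p" for p
  proof -
    have "\<bar>real (param_n C\<^sub>0 p) - real p / C\<^sub>0\<bar> * real p \<le> 1 * real p"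
      using param_n_bounds[OF assms, of p] by (intro mult_right_mono) auto
    then have "\<bar>real (param_n C\<^sub>0 p) * real p - (real p)\<^sup>2 / C\<^sub>0\<bar> \<le> real p"
      by (simp add: abs_mult_pos left_diff_distrib power2_eq_square)
    moreover have "(real p)\<^sup>2 / (10 * C\<^sub>0) = (real p)\<^sup>2 / C\<^sub>0 / 10" by simp
    ultimately show ?thesis by linarith
  qed
  have o: "(\<lambda>p. real p + 1) \<in> o(\<lambda>p. (real p)\<^sup>2 / (10 * C\<^sub>0))" using assms by real_asymp
  have small: "f \<sim>[at_top] (\<lambda>p. (real p)\<^sup>2 / (10 * C\<^sub>0))"
    if "\<And>p. \<bar>f p - (real p)\<^sup>2 / (10 * C\<^sub>0)\<bar> \<le> real p + 1" for f
  proof (rule smallo_imp_asymp_equiv, rule landau_o.big_small_trans[OF _ o])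
    show "(\<lambda>p. f p - (real p)\<^sup>2 / (10 * C\<^sub>0)) \<in> O(\<lambda>p. real p + 1)"
      by (rule bigoI[of _ 1]) (use that in simp)
  qed
  show "(\<lambda>p. real (param_n C\<^sub>0 p) * real p / 10) \<sim>[at_top] (\<lambda>p. (real p)\<^sup>2 / (10 * C\<^sub>0))"
    by (rule small) (use close in \<open>smt (verit)\<close>)
  show "(\<lambda>p. real (param_n C\<^sub>0 p * p div 10)) \<sim>[at_top] (\<lambda>p. (real p)\<^sup>2 / (10 * C\<^sub>0))"
  proof (rule small)
    fix p show "\<bar>real (param_n C\<^sub>0 p * p div 10) - (real p)\<^sup>2 / (10 * C\<^sub>0)\<bar> \<le> real p + 1"
      using close[of p] div10_bounds[of "param_n C\<^sub>0 p * p"] unfolding of_nat_mult by linarith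
  qed
qed

lemma asymp_equiv_filter_mono:
  fixes f g :: "'a \<Rightarrow> 'b::real_normed_field"
  assumes "f \<sim>[F] g" "F' \<le> F"
  shows "f \<sim>[F'] g"
  using assms unfolding asymp_equiv_def by (rule tendsto_mono[rotated])

text \<open>
  Both sides are \<open>m / p ^ r\<close> with \<open>m\<close> the mean fiber. The error \<open>E\<close> consists of
  \<open>ln m = O(ln p)\<close> and of the rounding \<open>c n - r ln p\<close>, which lies between \<open>- ln p\<close> and \<open>0\<close>
  by the definition of \<open>r\<close>.
\<close>

lemma density_exponent:
  assumes C: "C\<^sub>0 > 0" and c: "c > 0"
  shows "\<exists>E \<in> O[at_top](\<lambda>p. ln (real p)). \<forall>\<^sub>F p in at_top.
    real (p ^ param_b C\<^sub>0 c p * (param_n C\<^sub>0 p * p div 10)) / real p ^ param_n C\<^sub>0 p =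
    exp (- c * real (param_n C\<^sub>0 p) + E p)"
proof -
  define m where "m p = param_n C\<^sub>0 p * p div 10" for p
  define E where "E p = ln (real (m p)) + (c * real (param_n C\<^sub>0 p) - real (param_r C\<^sub>0 c p) * ln (real p))" for p
  have ev: "\<forall>\<^sub>F p::nat in at_top. 20 \<le> real p / C\<^sub>0 - 1" using C by real_asymp
  have "\<forall>\<^sub>F p::nat in at_top. (real p)\<^sup>2 / C\<^sub>0 \<le> real p ^ 3" using C by real_asymp
  with ev have bound: "\<forall>\<^sub>F p in at_top. \<bar>E p\<bar> \<le> 4 * \<bar>ln (real p)\<bar>" using eventually_ge_at_top[of 2]
  proof eventually_elim
    case (elim p)
    have ln: "ln (real p) > 0" using elim by simp
    have n: "20 \<le> real (param_n C\<^sub>0 p)" "real (param_n C\<^sub>0 p) \<le> real p / C\<^sub>0"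
      using param_n_bounds[OF C, of p] elim by linarith+
    have "20 * 2 \<le> real (param_n C\<^sub>0 p) * real p" by (rule mult_mono) (use n elim in auto)
    then have m1: "1 \<le> real (m p)" using div10_bounds(1)[of "param_n C\<^sub>0 p * p"] by (simp add: m_def)
    have "real (param_n C\<^sub>0 p) * real p \<le> real p / C\<^sub>0 * real p" by (rule mult_right_mono) (use n in auto)
    also have "\<dots> = (real p)\<^sup>2 / C\<^sub>0" by (simp add: power2_eq_square)
    finally have "real (param_n C\<^sub>0 p) * real p \<le> real p ^ 3" using elim by linarith
    moreover have "real (m p) \<le> real (param_n C\<^sub>0 p) * real p / 10"
      using div10_bounds(2)[of "param_n C\<^sub>0 p * p"] unfolding m_def of_nat_mult .
    moreover have "0 \<le> real (param_n C\<^sub>0 p) * real p" by simp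
    ultimately have "real (m p) \<le> real p ^ 3" by linarith
    then have "ln (real (m p)) \<le> ln (real p ^ 3)" 
      by (subst ln_le_cancel_iff) (use m1 elim(3) in auto)
    then have l: "0 \<le> ln (real (m p))" "ln (real (m p)) \<le> 3 * ln (real p)"
      using m1 elim by (simp_all add: ln_realpow)
    note r = param_r_bounds[OF c elim(3), of C\<^sub>0]
    have "c * real (param_n C\<^sub>0 p) \<le> real (param_r C\<^sub>0 c p) * ln (real p)"
      using r(1) by (simp only: pos_divide_le_eq[OF ln])
    moreover have "real (param_r C\<^sub>0 c p) - 1 < c * real (param_n C\<^sub>0 p) / ln (real p)"
      using r(2) by linarith
    then have "real (param_r C\<^sub>0 c p) * ln (real p) - ln (real p) < c * real (param_n C\<^sub>0 p)"
      by (simp only: pos_less_divide_eq[OF ln] left_diff_distrib mult_1_left)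
    ultimately show ?case using l ln unfolding E_def by linarith
  qed
  have "\<forall>\<^sub>F p in at_top. real (p ^ param_b C\<^sub>0 c p * m p) / real p ^ param_n C\<^sub>0 p =
    exp (- c * real (param_n C\<^sub>0 p) + E p)"
    using ev eventually_params_admissible[OF C c] eventually_ge_at_top[of 2]
  proof eventually_elim
    case (elim p)
    have n: "20 \<le> real (param_n C\<^sub>0 p)" using param_n_bounds[OF C, of p] elim by linarith
    have "20 * 2 \<le> real (param_n C\<^sub>0 p) * real p" by (rule mult_mono) (use n elim in auto)
    then have m1: "0 < real (m p)" using div10_bounds(1)[of "param_n C\<^sub>0 p * p"] by (simp add: m_def)
    have "real p ^ param_n C\<^sub>0 p = real p ^ param_b C\<^sub>0 c p * real p ^ param_r C\<^sub>0 c p"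
      using elim by (simp add: param_b_def flip: power_add)
    then have "real (p ^ param_b C\<^sub>0 c p * m p) / real p ^ param_n C\<^sub>0 p =
        real (m p) / real p ^ param_r C\<^sub>0 c p" using elim by simp
    also have "\<dots> = exp (ln (real (m p)) - real (param_r C\<^sub>0 c p) * ln (real p))"
      using m1 elim by (simp add: exp_diff exp_of_nat_mult)
    finally show ?case by (simp add: E_def)
  qed
  moreover have "E \<in> O[at_top](\<lambda>p. ln (real p))"
    using bound by (intro bigoI[of _ 4]) simp
  ultimately show ?thesis unfolding m_def by blast
qed

text \<open>
  An empty fiber violates the lower bound of balancedness, as the mean is positive.
\<close>

lemma balanced_fraction_eq_0:
  assumes miss: "all_maps_miss p n b S" and mean: "mean_fiber p b S > 0" and "\<tau> < 1"
  shows "balanced_fraction p n b \<tau> S = 0"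
proof -
  have "\<not> balanced p b \<tau> S L" if L: "L \<in> Fp_surj_linear_maps p n b" for L
  proof
    assume bal: "balanced p b \<tau> S L"
    have "L \<in> Fp_linear_maps p n b" using L by (simp add: Fp_surj_linear_maps_def)
    then obtain y where "y \<in> carrier (Fp_space p b)" "fiber L S y = {}"
      using miss unfolding all_maps_miss_def by meson
    then have "(1 - \<tau>) * mean_fiber p b S \<le> 0" using bal by (force simp: balanced_def)
    moreover have "0 < (1 - \<tau>) * mean_fiber p b S" using assms by simp
    ultimately show False by linarith
  qed
  then have none: "{L \<in> Fp_surj_linear_maps p n b. balanced p b \<tau> S L} = {}" by blast
  show ?thesis unfolding balanced_fraction_def none by simp
qed

text \<open>
  Eventually the threshold is at most \<open>(C\<^sub>0 / 20) n\<^sup>2 \<le> p\<^sup>2 / (20 C\<^sub>0)\<close>, half of the asymptotic mean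
  fiber \<open>p\<^sup>2 / (10 C\<^sub>0)\<close>.
\<close>

lemma eventually_threshold_le:
  assumes C: "C\<^sub>0 > 0" and T: "T \<in> o(\<lambda>k. (real k)\<^sup>2)"
  shows "\<forall>\<^sub>F p in at_top. T (param_n C\<^sub>0 p) \<le> real (param_n C\<^sub>0 p * p div 10)"
proof -
  have "\<forall>\<^sub>F k in at_top. norm (T k) \<le> C\<^sub>0 / 20 * norm ((real k)\<^sup>2)"
    by (rule landau_o.smallD[OF T]) (use C in simp)
  then have "\<forall>\<^sub>F p in at_top. norm (T (param_n C\<^sub>0 p)) \<le> C\<^sub>0 / 20 * norm ((real (param_n C\<^sub>0 p))\<^sup>2)"
    by (rule eventually_compose_filterlim[OF _ filterlim_param_n[OF C]])
  moreover have "\<forall>\<^sub>F p::nat in at_top. (real p)\<^sup>2 / (20 * C\<^sub>0) \<le> (real p / C\<^sub>0 - 1) * real p / 10 - 1"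
    using C by real_asymp
  ultimately show ?thesis
  proof eventually_elim
    case (elim p)
    note n = param_n_bounds[OF C, of p]
    have "T (param_n C\<^sub>0 p) \<le> C\<^sub>0 / 20 * (real (param_n C\<^sub>0 p))\<^sup>2" using elim(1) by simp
    also have "\<dots> \<le> C\<^sub>0 / 20 * (real p / C\<^sub>0)\<^sup>2"
      using n C by (intro mult_left_mono power_mono) auto
    also have "\<dots> = (real p)\<^sup>2 / (20 * C\<^sub>0)" using C by (simp add: power2_eq_square)
    also have "\<dots> \<le> (real p / C\<^sub>0 - 1) * real p / 10 - 1" by (rule elim(2))
    also have "\<dots> \<le> real (param_n C\<^sub>0 p) * real p / 10 - 1"
      using n by (intro diff_right_mono divide_right_mono mult_right_mono) auto
    also have "\<dots> \<le> real (param_n C\<^sub>0 p * p div 10)"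
      using div10_bounds(1)[of "param_n C\<^sub>0 p * p"] by simp
    finally show ?case .
  qed
qed

theorem corollary1p8:
  fixes C\<^sub>0 c :: real
  assumes "C\<^sub>0 > 0" and "c > 0"
  shows
    "let n = param_n C\<^sub>0; b = param_b C\<^sub>0 c in
     (\<exists>S :: nat \<Rightarrow> (nat \<Rightarrow> int) set.
        (\<forall>\<^sub>F p in primes_at_top.
           S p \<noteq> {} \<and> S p \<subseteq> carrier (Fp_space p (n p)) \<and>
           all_maps_miss p (n p) (b p) (S p) \<and>
           (\<forall>m::nat. 0 < m \<and> m \<le> card (S p) \<longrightarrow>
              (\<exists>S'. S' \<subseteq> S p \<and> card S' = m \<and> all_maps_miss p (n p) (b p) S'))) \<and>
        (\<lambda>p. mean_fiber p (b p) (S p)) \<sim>[primes_at_top] (\<lambda>p. real (n p) * real p / 10) \<and>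
        (\<lambda>p. mean_fiber p (b p) (S p)) \<sim>[primes_at_top] (\<lambda>p. (real p)\<^sup>2 / (10 * C\<^sub>0)) \<and>
        (\<exists>E :: nat \<Rightarrow> real. E \<in> O[primes_at_top](\<lambda>p. ln (real p)) \<and>
           (\<forall>\<^sub>F p in primes_at_top.
              real (card (S p)) / real p ^ n p = exp (- c * real (n p) + E p)))) \<and>
     (\<forall>(\<tau>::real) (\<delta>::real) (T :: nat \<Rightarrow> real).
        0 < \<tau> \<and> \<tau> < 1 \<and> 0 < \<delta> \<and> \<delta> < 1 \<and> T \<in> o(\<lambda>k. (real k)\<^sup>2) \<longrightarrow>
        \<not> (\<forall>\<^sub>F p in primes_at_top.
             \<forall>S'. S' \<noteq> {} \<and> S' \<subseteq> carrier (Fp_space p (n p)) \<and> mean_fiber p (b p) S' \<ge> T (n p) \<longrightarrow>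
               balanced_fraction p (n p) (b p) \<tau> S' \<ge> 1 - \<delta>))"
proof -
  define n where "n = param_n C\<^sub>0"
  define b where "b = param_b C\<^sub>0 c"
  define m where "m p = n p * p div 10" for p
  define good where "good p S \<longleftrightarrow> S \<subseteq> carrier (Fp_space p (n p)) \<and> card S = p ^ b p * m p \<and>
    all_maps_miss p (n p) (b p) S" for p S
  define S where "S p = (SOME S. good p S)" for p
  have good: "\<forall>\<^sub>F p in primes_at_top. good p (S p)"
    using eventually_ex_missed_set[OF assms]
  proof eventually_elim
    case (elim p)
    then have "\<exists>S. good p S" by (auto simp: good_def n_def b_def m_def)
    then show ?case unfolding S_def by (rule someI_ex)
  qed
  have prime: "\<forall>\<^sub>F p in primes_at_top. prime p"
    by (rule eventually_mono[OF eventually_odd_primes_at_top]) simp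
  have m_pos: "\<forall>\<^sub>F p in primes_at_top. m p > 0"
  proof (rule filter_leD[OF primes_at_top_le])
    have "(\<lambda>_. 1) \<in> o(\<lambda>k. (real k)\<^sup>2)" by real_asymp
    from eventually_threshold_le[OF assms(1) this]
    have "\<forall>\<^sub>F p in at_top. 1 \<le> real (m p)" unfolding m_def n_def .
    then show "\<forall>\<^sub>F p in at_top. m p > 0" by eventually_elim simp
  qed
  have mean: "\<forall>\<^sub>F p in primes_at_top. real (m p) = mean_fiber p (b p) (S p)"
    using good prime
    by eventually_elim (auto simp: good_def mean_fiber_of_card prime_gt_0_nat)
  have nonempty: "\<forall>\<^sub>F p in primes_at_top. S p \<noteq> {}"
    using good prime m_pos
  proof eventually_elim
    case (elim p)
    then have "card (S p) > 0" by (simp add: good_def prime_gt_0_nat)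
    then show ?case by auto
  qed
  have sets: "\<forall>\<^sub>F p in primes_at_top. S p \<noteq> {} \<and> S p \<subseteq> carrier (Fp_space p (n p)) \<and>
      all_maps_miss p (n p) (b p) (S p) \<and>
      (\<forall>k::nat. 0 < k \<and> k \<le> card (S p) \<longrightarrow>
        (\<exists>S'. S' \<subseteq> S p \<and> card S' = k \<and> all_maps_miss p (n p) (b p) S'))"
    using good nonempty
  proof eventually_elim
    case (elim p)
    have "\<exists>S'. S' \<subseteq> S p \<and> card S' = k \<and> all_maps_miss p (n p) (b p) S'" if k: "k \<le> card (S p)" for k
    proof -
      obtain S' where "S' \<subseteq> S p" "card S' = k" using obtain_subset_with_card_n[OF k] by metis
      then show ?thesis using elim all_maps_miss_mono unfolding good_def by blast
    qed
    then show ?case using elim unfolding good_def by blast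
  qed
  have equiv_m: "(\<lambda>p. real (m p)) \<sim>[primes_at_top] (\<lambda>p. (real p)\<^sup>2 / (10 * C\<^sub>0))"
    unfolding m_def n_def
    by (rule asymp_equiv_filter_mono[OF mean_equiv(1)[OF assms(1)] primes_at_top_le])
  have equiv_np: "(\<lambda>p. real (n p) * real p / 10) \<sim>[primes_at_top] (\<lambda>p. (real p)\<^sup>2 / (10 * C\<^sub>0))"
    unfolding n_def
    by (rule asymp_equiv_filter_mono[OF mean_equiv(2)[OF assms(1)] primes_at_top_le])
  have equiv_p: "(\<lambda>p. mean_fiber p (b p) (S p)) \<sim>[primes_at_top] (\<lambda>p. (real p)\<^sup>2 / (10 * C\<^sub>0))"
    by (rule asymp_equiv_transfer[OF equiv_m mean]) simp
  have equiv_n: "(\<lambda>p. mean_fiber p (b p) (S p)) \<sim>[primes_at_top] (\<lambda>p. real (n p) * real p / 10)"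
    by (rule asymp_equiv_trans[OF equiv_p asymp_equiv_symI[OF equiv_np]])
  obtain E where E: "E \<in> O[at_top](\<lambda>p. ln (real p))"
    and E_eq: "\<forall>\<^sub>F p in at_top. real (p ^ b p * m p) / real p ^ n p = exp (- c * real (n p) + E p)"
    using density_exponent[OF assms] unfolding n_def b_def m_def by blast
  have density: "\<forall>\<^sub>F p in primes_at_top. real (card (S p)) / real p ^ n p = exp (- c * real (n p) + E p)"
    using good filter_leD[OF primes_at_top_le E_eq] by eventually_elim (simp add: good_def)
  have E': "E \<in> O[primes_at_top](\<lambda>p. ln (real p))"
    using landau_o.big.filter_mono[OF primes_at_top_le E] .
  have no_threshold: "\<not> (\<forall>\<^sub>F p in primes_at_top.
      \<forall>S'. S' \<noteq> {} \<and> S' \<subseteq> carrier (Fp_space p (n p)) \<and> mean_fiber p (b p) S' \<ge> T (n p) \<longrightarrow>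
        balanced_fraction p (n p) (b p) \<tau> S' \<ge> 1 - \<delta>)"
    if \<tau>: "\<tau> < 1" and \<delta>: "\<delta> < 1" and T: "T \<in> o(\<lambda>k. (real k)\<^sup>2)" for \<tau> \<delta> :: real and T
  proof
    assume all: "\<forall>\<^sub>F p in primes_at_top.
      \<forall>S'. S' \<noteq> {} \<and> S' \<subseteq> carrier (Fp_space p (n p)) \<and> mean_fiber p (b p) S' \<ge> T (n p) \<longrightarrow>
        balanced_fraction p (n p) (b p) \<tau> S' \<ge> 1 - \<delta>"
    have T_le: "\<forall>\<^sub>F p in primes_at_top. T (n p) \<le> real (m p)"
      unfolding n_def m_def
      by (rule filter_leD[OF primes_at_top_le eventually_threshold_le[OF assms(1) T]])
    have "\<forall>\<^sub>F p in primes_at_top. False"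
      using all sets mean m_pos T_le
    proof eventually_elim
      case (elim p)
      have "T (n p) \<le> mean_fiber p (b p) (S p)" using elim(3,5) by linarith
      then have "balanced_fraction p (n p) (b p) \<tau> (S p) \<ge> 1 - \<delta>" using elim(1,2) by blast
      moreover have "balanced_fraction p (n p) (b p) \<tau> (S p) = 0"
      proof (rule balanced_fraction_eq_0)
        show "all_maps_miss p (n p) (b p) (S p)" using elim(2) by blast
        show "mean_fiber p (b p) (S p) > 0" using elim(3,4) by linarith
      qed (rule \<tau>)
      ultimately show False using \<delta> by linarith
    qed
    then show False using primes_at_top_neq_bot by (simp add: trivial_limit_def)
  qed
  show ?thesis
    unfolding Let_def n_def[symmetric] b_def[symmetric]
    using sets equiv_n equiv_p E' density no_threshold
    by (intro conjI exI[of _ S] exI[of _ E] allI impI) blast+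
qed

end
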